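(* Let $f\in V^*$ and $y\in V$. Then $y$ solves the quasi-variational inequality $$y\le \Phi(y),\qquad \langle Ay-f,\,y-v\rangle\le 0\quad\text{for all } v\in V \text{ with } v\le\Phi(y),$$ if and only if, with $\xi:=f-Ay\in V^*$, the following complementarity system holds: $$\xi\ge 0 \text{ in } V^*,\qquad \langle \xi,\Phi(y)-y\rangle=0,\qquad 0\le \Phi(y)-y .$$
   Context: $V$ is a real reflexive Banach space with dual $V^*$ and duality pairing $\langle\cdot,\cdot\rangle$. $V$ is a vector lattice for a partial order $\le$: $\le$ is reflexive, antisymmetric and transitive; $u\le v$ implies $u+w\le v+w$ and $\lambda u\le\lambda v$ for all $w\in V$, $\lambda\ge 0$; and any $u,v\in V$ have a greatest lower bound $\inf(u,v)$ and a least upper bound $\sup(u,v)$ in $V$. $V_+:=\{v\in V: v\ge 0\}$. For $f,g\in V^*$, $f\le g$ in $V^*$ means $\langle g-f,v\rangle\ge 0$ for all $v\in V_+$. With $u^+:=\sup(0,u)$, $u^-:=u^+-u$, the operator $A\colon V\to V^*$ is linear and there are constants $C_a,C_b>0$ with $\langle Au,v\rangle\le C_b\|u\|_V\|v\|_V$, $\langle Au,u\rangle\ge C_a\|u\|_V^2$ and $\langle Au^+,u^-\rangle\le 0$ for all $u,v\in V$. $\Phi\colon V\to V$ is a given map. *)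

theory Defs
  imports "HOL-Analysis.Analysis"
begin

(* The dual of 'a is the type "'a \<Rightarrow>\<^sub>L real" of bounded linear functionals, and the
   duality pairing is blinfun_apply. *)

definition bidual_embedding ::
    "'a::real_normed_vector \<Rightarrow> (('a \<Rightarrow>\<^sub>L real) \<Rightarrow>\<^sub>L real)" where
  "bidual_embedding x = Blinfun (\<lambda>f. blinfun_apply f x)"

lemma bidual_embedding_apply: "blinfun_apply (bidual_embedding x) f = blinfun_apply f x"
  unfolding bidual_embedding_def
  by (simp add: bounded_linear_Blinfun_apply blinfun.bounded_linear_left)

definition reflexive_space :: "'a::real_normed_vector itself \<Rightarrow> bool" where
  "reflexive_space _ \<longleftrightarrow>
     surj (bidual_embedding :: 'a \<Rightarrow> (('a \<Rightarrow>\<^sub>L real) \<Rightarrow>\<^sub>L real))"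

(* No order on the type of functionals exists in the library, hence a separate relation. *)
definition dual_le ::
    "('a::{real_normed_vector,ord} \<Rightarrow>\<^sub>L real) \<Rightarrow> ('a \<Rightarrow>\<^sub>L real) \<Rightarrow> bool" where
  "dual_le f g \<longleftrightarrow> (\<forall>v. 0 \<le> v \<longrightarrow> blinfun_apply (g - f) v \<ge> 0)"

definition pos_part :: "'a::{zero,sup} \<Rightarrow> 'a" where
  "pos_part u = sup 0 u"

(* Nonnegative convention: u = pos_part u - neg_part u, unlike the nprt of the library. *)
definition neg_part :: "'a::{group_add,sup} \<Rightarrow> 'a" where
  "neg_part u = pos_part u - u"

end

theory Submission
  imports Defs
begin

text \<open>With \<open>y\<close> fixed, the admissible \<open>v\<close> form the shifted cone of
  all \<open>\<Phi> y - w\<close> with \<open>w \<ge> 0\<close>, and the variational inequality says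
  that the linear functional \<open>\<xi> = f - A y\<close> attains its maximum over this cone at
  \<open>y\<close>. A linear functional bounded above on such a cone is nonnegative on positive
  elements and is then maximal at the apex \<open>\<Phi> y\<close>. Hence \<open>y\<close> is a
  maximizer exactly when \<open>\<xi>\<close> is nonnegative and takes equal values at
  \<open>y\<close> and at the apex.\<close>

theorem proposition2p1:
  fixes A :: "'a::{banach,ordered_real_vector,lattice} \<Rightarrow> ('a \<Rightarrow>\<^sub>L real)"
    and \<Phi> :: "'a \<Rightarrow> 'a"
    and C\<^sub>a C\<^sub>b :: real
    and f :: "'a \<Rightarrow>\<^sub>L real"
    and y :: 'a
  assumes "reflexive_space TYPE('a)"
    and "linear A"
    and "C\<^sub>a > 0" and "C\<^sub>b > 0"
    and "\<And>u v. blinfun_apply (A u) v \<le> C\<^sub>b * norm u * norm v"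
    and "\<And>u. blinfun_apply (A u) u \<ge> C\<^sub>a * (norm u)\<^sup>2"
    and "\<And>u. blinfun_apply (A (pos_part u)) (neg_part u) \<le> 0"
  shows "(y \<le> \<Phi> y \<and> (\<forall>v. v \<le> \<Phi> y \<longrightarrow> blinfun_apply (A y - f) (y - v) \<le> 0))
    \<longleftrightarrow>
    (let \<xi> = f - A y in
       dual_le 0 \<xi> \<and> blinfun_apply \<xi> (\<Phi> y - y) = 0 \<and> 0 \<le> \<Phi> y - y)"
proof -
  define \<xi> where "\<xi> = f - A y"
  have VI: "blinfun_apply (A y - f) (y - v) = blinfun_apply \<xi> (v - y)" for v
    by (simp add: \<xi>_def blinfun.diff_left blinfun.diff_right)
  have "(y \<le> \<Phi> y \<and> (\<forall>v. v \<le> \<Phi> y \<longrightarrow> blinfun_apply \<xi> (v - y) \<le> 0))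
    \<longleftrightarrow> dual_le 0 \<xi> \<and> blinfun_apply \<xi> (\<Phi> y - y) = 0 \<and> 0 \<le> \<Phi> y - y"
    (is "?QVI \<longleftrightarrow> ?CS")
  proof
    assume ?QVI
    then have le: "y \<le> \<Phi> y" and VI: "\<And>v. v \<le> \<Phi> y \<Longrightarrow> blinfun_apply \<xi> (v - y) \<le> 0"
      by auto
    have nonneg: "0 \<le> blinfun_apply \<xi> w" if "0 \<le> w" for w
    proof -
      \<comment> \<open>Moving down from \<open>y\<close> by a positive \<open>w\<close> stays
        admissible; testing with \<open>v = y - w\<close> gives
        \<open>- \<xi> w \<le> 0\<close>.\<close>
      have "y - w \<le> \<Phi> y"
        using that le by (metis add_increasing2 diff_le_eq)
      from VI[OF this] show ?thesis
        by (simp add: blinfun.minus_right)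
    qed
    \<comment> \<open>Testing with the apex \<open>v = \<Phi> y\<close> bounds the pairing above by
      0; positivity of \<open>\<xi>\<close> bounds it below.\<close>
    moreover have "blinfun_apply \<xi> (\<Phi> y - y) = 0"
      using VI[of "\<Phi> y"] nonneg[of "\<Phi> y - y"] le by simp
    ultimately show ?CS
      using le by (simp add: dual_le_def)
  next
    assume CS: ?CS
    have "blinfun_apply \<xi> (v - y) \<le> 0" if "v \<le> \<Phi> y" for v
    proof -
      \<comment> \<open>Splitting \<open>v - y = (\<Phi> y - y) - (\<Phi> y - v)\<close>,
        complementarity removes the first term and positivity of \<open>\<xi>\<close> fixes the sign
        of the second.\<close>
      have "0 \<le> blinfun_apply \<xi> (\<Phi> y - v)"
        using CS that by (simp add: dual_le_def)
      then show ?thesis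
        using CS by (simp add: blinfun.diff_right)
    qed
    with CS show ?QVI
      by simp
  qed
  then show ?thesis
    by (simp only: VI Let_def flip: \<xi>_def)
qed

end
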